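(* Fix $u\in(0,1/2]$. As $d\to\infty$ (through integers), \[ \widehat A_d(u) = d(1-u)-2(1-u)\sqrt{d\log\!\big(u^{-u}(1-u)^{u-1}\big)} +o(\sqrt d). \] Hence \[ i_{E,u}(d)\ \ge\ d\,(1-u+o(1))\qquad (d\to\infty). \]
   Context: For a graph $G$ on $n$ vertices with vertex set $V$ and $U\subseteq V$, $\partial_E(U)$ is the set of edges with exactly one endpoint in $U$. For $0<u\le 1/2$, $i_{E,u}(G)=\min |\partial_E(U)|/|U|$ over nonempty $U\subseteq V$ with $|U|\le un$. $\mathcal G_{n,d}$ is the uniform probability space on simple $d$-regular graphs on $n$ (labelled) vertices ($dn$ even; $n\to\infty$ through such $n$). A property holds a.a.s. if its probability tends to $1$ as $n\to\infty$ (with $d$ fixed). Define $i_{E,u}(d)=\sup\{\ell : i_{E,u}(\mathcal G_{n,d})\ge \ell \text{ a.a.s.}\}$. For $d\ge 3$ and $0<u\le 1/2$, with the convention $0\log 0=0$, for $0\le y\le du$ let \[ \begin{aligned} \widehat f_d(u,y)=\ &du\log(du)+(d-du)\log(d-du)-u\log u-(1-u)\log(1-u)-y\log y\\ &-\tfrac12\big((du-y)\log(du-y)+(d-du-y)\log(d-du-y)+d\log d\big), \end{aligned} \] and $\widehat A_d(u)=\frac1u\min\{y:\widehat f_d(u,y)\ge 0\}$. Equivalently, $\widehat A_d(u)=y_{d,u}/u$ where $y_{d,u}$ is the smallest positive solution $y$ of $d^{d/2}u^{(d-1)u}(1-u)^{(d-1)(1-u)}=(du-y)^{(du-y)/2}(d-du-y)^{(d-du-y)/2}y^y$.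 *)

theory Defs
  imports "HOL-Probability.Probability" "HOL-Library.Landau_Symbols"
begin

text \<open>
  A simple graph on the labelled vertex set \<open>{..<n}\<close> is given by its set of edges, each edge being
  a two-element set of vertices.
\<close>

definition regular_graphs :: "nat \<Rightarrow> nat \<Rightarrow> nat set set set" where
  "regular_graphs n d =
     {E. E \<subseteq> {e. e \<subseteq> {..<n} \<and> card e = 2} \<and> (\<forall>v<n. card {e \<in> E. v \<in> e} = d)}"

definition edge_boundary :: "nat set set \<Rightarrow> nat set \<Rightarrow> nat set set" where
  "edge_boundary E U = {e \<in> E. card (e \<inter> U) = 1}"

text \<open>
  \<open>Min\<close> is unspecified on the empty set, so the following quantity is meaningful only for
  \<open>u * n \<ge> 1\<close>; for fixed \<open>u > 0\<close> this excludes only finitely many \<open>n\<close>.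
\<close>

definition edge_expansion :: "real \<Rightarrow> nat \<Rightarrow> nat set set \<Rightarrow> real" where
  "edge_expansion u n E =
     Min {real (card (edge_boundary E U)) / real (card U) | U.
            U \<subseteq> {..<n} \<and> U \<noteq> {} \<and> real (card U) \<le> u * real n}"

text \<open>
  The limit runs through those \<open>n\<close> with \<open>d * n\<close> even. For such \<open>n > d\<close> the set of
  \<open>d\<close>-regular graphs is nonempty, as \<open>pmf_of_set\<close> requires.
\<close>

definition aas :: "nat \<Rightarrow> (nat \<Rightarrow> nat set set \<Rightarrow> bool) \<Rightarrow> bool" where
  "aas d P \<longleftrightarrow>
     ((\<lambda>n. measure_pmf.prob (pmf_of_set (regular_graphs n d)) {E. P n E}) \<longlongrightarrow> 1)
       (at_top \<sqinter> principal {n. even (d * n)})"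

definition regular_expansion :: "real \<Rightarrow> nat \<Rightarrow> real" where
  "regular_expansion u d = Sup {l. aas d (\<lambda>n E. edge_expansion u n E \<ge> l)}"

text \<open>The convention \<open>0 log 0 = 0\<close> is automatic, each logarithm being multiplied by its argument.\<close>

definition f_hat :: "nat \<Rightarrow> real \<Rightarrow> real \<Rightarrow> real" where
  "f_hat d u y =
     d * u * ln (d * u) + (d - d * u) * ln (d - d * u)
     - u * ln u - (1 - u) * ln (1 - u) - y * ln y
     - 1 / 2 * ((d * u - y) * ln (d * u - y) + (d - d * u - y) * ln (d - d * u - y) + d * ln d)"

definition A_hat :: "nat \<Rightarrow> real \<Rightarrow> real" where
  "A_hat d u = 1 / u * (LEAST y. 0 \<le> y \<and> y \<le> d * u \<and> f_hat d u y \<ge> 0)"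

end

theory Submission
  imports Defs
begin

text \<open>
  The two halves of the theorem have independent proofs.

  For the expansion of \<^const>\<open>A_hat\<close>, put \<open>y = d v\<close>. Then \<^const>\<open>f_hat\<close> becomes \<open>d\<close> times a
  function of \<open>u\<close> and \<open>v\<close> alone (\<open>rate\<close>), plus the entropy \<open>h\<close> of \<open>u\<close>
  (\<open>f_hat_eq_rate\<close>). The rate increases up to \<open>v = u (1 - u)\<close>, where it has a double zero with
  second derivative \<open>- 1 / (2 (u (1 - u))\<^sup>2)\<close>. The least \<open>v\<close> at which the rate reaches \<open>- h / d\<close> is
  therefore \<open>u (1 - u) - 2 u (1 - u) sqrt (h / d)\<close> up to \<open>o (1 / sqrt d)\<close>
  (\<open>A_hat_eventually_near\<close>), and multiplication by \<open>d / u\<close> gives the claim.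

  The lower bound for \<^const>\<open>regular_expansion\<close> only asks for the leading term, and a switching
  argument carried out directly on simple graphs is precise enough for that. Fix \<open>U\<close> with
  \<open>s \<le> u n\<close> vertices. Replacing an edge \<open>ab\<close> inside \<open>U\<close> and an edge \<open>xy\<close> outside \<open>U\<close> by \<open>ax\<close> and \<open>by\<close> keeps the graph \<open>d\<close>-regular and adds two edges to the
  boundary of \<open>U\<close>. Counting these switches in both directions (\<open>switching_inequality\<close>) shows
  that, as long as the boundary has at most \<open>(1 - c) d s\<close> edges with \<open>c > u\<close>, graphs with two more
  boundary edges are more frequent by a factor of at least \<open>c n / s\<close>. A boundary that falls short of
  \<open>(1 - c) d s\<close> by a further \<open>\<delta> d s\<close> can be repaired by about \<open>\<delta> d s / 2\<close> switches, so it has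
  probability at most \<open>(s / (c n))\<close> to that power (\<open>card_small_boundary\<close>). For large \<open>d\<close> this
  outweighs the number of sets of size \<open>s\<close>, and the sum over all sets is \<open>O (1 / n)\<close>
  (\<open>card_weak_graphs\<close>).
\<close>

section \<open>Degree counting in regular graphs\<close>

text \<open>
  Ordered pairs let one count an edge once from each end, so that all degree sums become
  cardinalities of dependent products: an edge inside \<open>A\<close> gives two elements of
  \<open>arcs E A A\<close>, an edge between disjoint \<open>A\<close> and \<open>B\<close> one element of \<open>arcs E A B\<close>.
\<close>

definition arcs :: "nat set set \<Rightarrow> nat set \<Rightarrow> nat set \<Rightarrow> (nat \<times> nat) set" where
  "arcs E A B = {(a, b). a \<in> A \<and> b \<in> B \<and> {a, b} \<in> E}"

lemma finite_arcs: "finite A \<Longrightarrow> finite B \<Longrightarrow> finite (arcs E A B)"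
  by (rule finite_subset[of _ "A \<times> B"]) (auto simp: arcs_def)

lemma finite_regular_graphs: "finite (regular_graphs n d)"
proof (rule finite_subset)
  show "regular_graphs n d \<subseteq> Pow (Pow {..<n})"
    by (auto simp: regular_graphs_def)
qed simp

lemma regular_graph_edge:
  assumes "E \<in> regular_graphs n d" and "{a, b} \<in> E"
  shows "a < n" and "b < n" and "a \<noteq> b"
proof -
  have "{a, b} \<subseteq> {..<n}" "card {a, b} = 2"
    using assms by (auto simp: regular_graphs_def)
  then show "a < n" "b < n" "a \<noteq> b" by auto
qed

lemma regular_graph_finite: "E \<in> regular_graphs n d \<Longrightarrow> finite E"
  by (rule finite_subset[of _ "Pow {..<n}"]) (auto simp: regular_graphs_def)

lemma card_neighbours:
  assumes E: "E \<in> regular_graphs n d" and v: "v < n"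
  shows "card {w. {v, w} \<in> E} = d"
proof -
  have "bij_betw (\<lambda>w. {v, w}) {w. {v, w} \<in> E} {e \<in> E. v \<in> e}"
    unfolding bij_betw_def
  proof
    show "inj_on (\<lambda>w. {v, w}) {w. {v, w} \<in> E}"
      by (auto simp: inj_on_def doubleton_eq_iff)
    show "(\<lambda>w. {v, w}) ` {w. {v, w} \<in> E} = {e \<in> E. v \<in> e}"
    proof (intro subset_antisym subsetI)
      fix e assume e: "e \<in> {e \<in> E. v \<in> e}"
      then have "card e = 2" using E by (auto simp: regular_graphs_def)
      then obtain p q where "e = {p, q}" by (auto simp: card_2_iff)
      with e have "\<exists>w. e = {v, w}" by auto
      then show "e \<in> (\<lambda>w. {v, w}) ` {w. {v, w} \<in> E}" using e by auto
    qed auto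
  qed
  then have "card {w. {v, w} \<in> E} = card {e \<in> E. v \<in> e}" by (rule bij_betw_same_card)
  also have "\<dots> = d" using E v by (auto simp: regular_graphs_def)
  finally show ?thesis .
qed

lemma finite_neighbours: "E \<in> regular_graphs n d \<Longrightarrow> finite {w. {v, w} \<in> E}"
  by (rule finite_subset[of _ "{..<n}"]) (auto dest: regular_graph_edge)

lemma card_arcs_swap: "card (arcs E A B) = card (arcs E B A)"
proof -
  have "arcs E B A = prod.swap ` arcs E A B"
    by (auto simp: arcs_def insert_commute image_iff)
  then show ?thesis by (simp add: card_image)
qed

lemma card_arcs_split:
  assumes E: "E \<in> regular_graphs n d" and A: "A \<subseteq> {..<n}" and B: "B \<subseteq> {..<n}"
  shows "card (arcs E A B) + card (arcs E A ({..<n} - B)) = d * card A"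
proof -
  have fin: "finite A" "finite B" using A B by (auto intro: finite_subset)
  have "arcs E A B \<union> arcs E A ({..<n} - B) = Sigma A (\<lambda>v. {w. {v, w} \<in> E})"
    using regular_graph_edge[OF E] by (auto simp: arcs_def)
  moreover have "card (Sigma A (\<lambda>v. {w. {v, w} \<in> E})) = (\<Sum>v\<in>A. card {w. {v, w} \<in> E})"
    using fin finite_neighbours[OF E] by (intro card_SigmaI) auto
  moreover have "(\<Sum>v\<in>A. card {w. {v, w} \<in> E}) = (\<Sum>v\<in>A. d)"
    using A by (intro sum.cong refl card_neighbours[OF E]) auto
  moreover have "card (arcs E A B \<union> arcs E A ({..<n} - B))
      = card (arcs E A B) + card (arcs E A ({..<n} - B))"
    using fin by (intro card_Un_disjoint finite_arcs) (auto simp: arcs_def)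
  ultimately show ?thesis by (simp add: mult.commute)
qed

lemma card_edge_boundary:
  assumes E: "E \<in> regular_graphs n d" and U: "U \<subseteq> {..<n}"
  shows "card (edge_boundary E U) = card (arcs E U ({..<n} - U))"
proof -
  have "bij_betw (\<lambda>(a, x). {a, x}) (arcs E U ({..<n} - U)) (edge_boundary E U)"
    unfolding bij_betw_def
  proof
    show "inj_on (\<lambda>(a, x). {a, x}) (arcs E U ({..<n} - U))"
      by (auto simp: inj_on_def arcs_def doubleton_eq_iff)
    show "(\<lambda>(a, x). {a, x}) ` arcs E U ({..<n} - U) = edge_boundary E U"
    proof (intro subset_antisym subsetI)
      fix e assume "e \<in> (\<lambda>(a, x). {a, x}) ` arcs E U ({..<n} - U)"
      then obtain a x where "e = {a, x}" "a \<in> U" "x \<notin> U" "{a, x} \<in> E"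
        by (auto simp: arcs_def)
      moreover from this have "e \<inter> U = {a}" by auto
      ultimately show "e \<in> edge_boundary E U" by (simp add: edge_boundary_def)
    next
      fix e assume e: "e \<in> edge_boundary E U"
      then have "card e = 2" "e \<in> E" using E by (auto simp: regular_graphs_def edge_boundary_def)
      then obtain p q where pq: "e = {p, q}" "p \<noteq> q" by (auto simp: card_2_iff)
      have "card (e \<inter> U) = 1" using e by (simp add: edge_boundary_def)
      then have "p \<in> U \<and> q \<notin> U \<or> q \<in> U \<and> p \<notin> U"
        using pq by (cases "p \<in> U"; cases "q \<in> U") auto
      then have "\<exists>a x. e = {a, x} \<and> a \<in> U \<and> x \<notin> U" using pq by (auto simp: insert_commute)
      then obtain a x where ax: "e = {a, x}" "a \<in> U" "x \<notin> U" by blast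
      then have "(a, x) \<in> arcs E U ({..<n} - U)"
        using regular_graph_edge[OF E] \<open>e \<in> E\<close> by (auto simp: arcs_def)
      then show "e \<in> (\<lambda>(a, x). {a, x}) ` arcs E U ({..<n} - U)" using ax by force
    qed
  qed
  then show ?thesis using bij_betw_same_card by metis
qed

section \<open>Switchings\<close>

text \<open>
  For edges \<open>ab\<close> inside \<open>U\<close> and \<open>xy\<close> outside \<open>U\<close> this keeps all degrees and adds
  exactly the two edges \<open>ax\<close> and \<open>by\<close> to the boundary of \<open>U\<close>.
\<close>

definition switch :: "nat set set \<Rightarrow> nat \<Rightarrow> nat \<Rightarrow> nat \<Rightarrow> nat \<Rightarrow> nat set set" where
  "switch E a b x y = (E - {{a, b}, {x, y}}) \<union> {{a, x}, {b, y}}"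

text \<open>
  A switch acts at each of its four vertices \<open>v\<close> in the same way: one of the two removed edges
  and one of the two added edges contain \<open>v\<close>.
\<close>

lemma degree_exchange:
  assumes "finite E" and "q \<in> E" and "p \<notin> E"
    and "v \<in> q" and "v \<in> p" and "v \<notin> q'" and "v \<notin> p'"
  shows "card {f \<in> (E - {q, q'}) \<union> {p, p'}. v \<in> f} = card {f \<in> E. v \<in> f}"
proof -
  have "{f \<in> (E - {q, q'}) \<union> {p, p'}. v \<in> f} = insert p ({f \<in> E. v \<in> f} - {q})"
    using assms by blast
  moreover have "card {f \<in> E. v \<in> f} > 0" using assms by (auto simp: card_gt_0_iff)
  ultimately show ?thesis using assms by simp
qed

lemma switch_regular:
  assumes E: "E \<in> regular_graphs n d"
    and U: "a \<in> U" "b \<in> U" "x \<notin> U" "y \<notin> U"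
    and edges: "{a, b} \<in> E" "{x, y} \<in> E" and new: "{a, x} \<notin> E" "{b, y} \<notin> E"
  shows "switch E a b x y \<in> regular_graphs n d"
proof -
  note e = regular_graph_edge[OF E edges(1)] regular_graph_edge[OF E edges(2)]
  have ne: "a \<noteq> x" "a \<noteq> y" "b \<noteq> x" "b \<noteq> y" using U by auto
  have fin: "finite E" using regular_graph_finite[OF E] .
  have deg: "card {f \<in> E. v \<in> f} = d" if "v < n" for v
    using E that by (auto simp: regular_graphs_def)
  have sw: "switch E a b x y = (E - {{a, b}, {x, y}}) \<union> {{b, y}, {a, x}}"
      "switch E a b x y = (E - {{x, y}, {a, b}}) \<union> {{a, x}, {b, y}}"
      "switch E a b x y = (E - {{x, y}, {a, b}}) \<union> {{b, y}, {a, x}}"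
    by (simp_all add: switch_def insert_commute)
  have "card {f \<in> switch E a b x y. v \<in> f} = d" if v: "v < n" for v
  proof -
    consider "v = a" | "v = b" | "v = x" | "v = y" | "v \<notin> {a, b, x, y}" by auto
    then show ?thesis
    proof cases
      case 1
      then show ?thesis unfolding switch_def
        using e ne by (subst degree_exchange[OF fin edges(1) new(1)]) (simp_all add: deg v)
    next
      case 2
      then show ?thesis unfolding sw(1)
        using e ne by (subst degree_exchange[OF fin edges(1) new(2)]) (simp_all add: deg v)
    next
      case 3
      then show ?thesis unfolding sw(2)
        using e ne by (subst degree_exchange[OF fin edges(2) new(1)]) (simp_all add: deg v)
    next
      case 4
      then show ?thesis unfolding sw(3)
        using e ne by (subst degree_exchange[OF fin edges(2) new(2)]) (simp_all add: deg v)
    next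
      case 5
      then have "{f \<in> switch E a b x y. v \<in> f} = {f \<in> E. v \<in> f}" by (auto simp: switch_def)
      then show ?thesis using deg v by simp
    qed
  qed
  moreover have "switch E a b x y \<subseteq> {f. f \<subseteq> {..<n} \<and> card f = 2}"
    using E e ne by (auto simp: switch_def regular_graphs_def)
  ultimately show ?thesis by (simp add: regular_graphs_def)
qed

lemma card_edge_boundary_switch:
  assumes E: "E \<in> regular_graphs n d"
    and U: "a \<in> U" "b \<in> U" "x \<notin> U" "y \<notin> U"
    and edges: "{a, b} \<in> E" "{x, y} \<in> E" and new: "{a, x} \<notin> E" "{b, y} \<notin> E"
  shows "card (edge_boundary (switch E a b x y) U) = card (edge_boundary E U) + 2"
proof -
  have ab: "a \<noteq> b" "x \<noteq> y" using regular_graph_edge[OF E] edges by blast+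
  have int: "{a, b} \<inter> U = {a, b}" "{x, y} \<inter> U = {}" "{a, x} \<inter> U = {a}" "{b, y} \<inter> U = {b}"
    using U by auto
  then have c: "card ({a, b} \<inter> U) = 2" "card ({x, y} \<inter> U) = 0"
      "card ({a, x} \<inter> U) = 1" "card ({b, y} \<inter> U) = 1"
    using ab by auto
  have "edge_boundary (switch E a b x y) U = edge_boundary E U \<union> {{a, x}, {b, y}}" (is "_ = ?R")
  proof (rule set_eqI)
    fix f
    show "f \<in> edge_boundary (switch E a b x y) U \<longleftrightarrow> f \<in> ?R"
      using c unfolding edge_boundary_def switch_def
      by (cases "f = {a, b}"; cases "f = {x, y}"; cases "f = {a, x}"; cases "f = {b, y}") simp_all
  qed
  moreover have "{a, x} \<noteq> {b, y}" using U ab by (auto simp: doubleton_eq_iff)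
  moreover have "edge_boundary E U \<inter> {{a, x}, {b, y}} = {}" using new by (auto simp: edge_boundary_def)
  moreover have "finite (edge_boundary E U)"
    using regular_graph_finite[OF E] by (simp add: edge_boundary_def)
  ultimately show ?thesis by (simp add: card_Un_disjoint)
qed

definition graphs_with_boundary :: "nat \<Rightarrow> nat \<Rightarrow> nat set \<Rightarrow> nat \<Rightarrow> nat set set set" where
  "graphs_with_boundary n d U b = {E \<in> regular_graphs n d. card (edge_boundary E U) = b}"

lemma finite_graphs_with_boundary: "finite (graphs_with_boundary n d U b)"
  using finite_regular_graphs by (simp add: graphs_with_boundary_def)

text \<open>
  There are \<open>d\<^sup>2\<close> walks of length two from a vertex. They are the pairs \<open>(x, y)\<close> for which
  a switch would duplicate an existing edge \<open>ax\<close>.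
\<close>

lemma card_two_step_walks:
  assumes E: "E \<in> regular_graphs n d" and a: "a < n"
  shows "finite {(x, y). {a, x} \<in> E \<and> {x, y} \<in> E}"
    and "card {(x, y). {a, x} \<in> E \<and> {x, y} \<in> E} = d * d"
proof -
  have eq: "{(x, y). {a, x} \<in> E \<and> {x, y} \<in> E} = Sigma {x. {a, x} \<in> E} (\<lambda>x. {y. {x, y} \<in> E})"
    by auto
  show "finite {(x, y). {a, x} \<in> E \<and> {x, y} \<in> E}"
    unfolding eq using finite_neighbours[OF E] by blast
  have "card (Sigma {x. {a, x} \<in> E} (\<lambda>x. {y. {x, y} \<in> E}))
      = (\<Sum>x\<in>{x. {a, x} \<in> E}. card {y. {x, y} \<in> E})"
    using finite_neighbours[OF E] by (intro card_SigmaI) auto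
  also have "\<dots> = (\<Sum>x\<in>{x. {a, x} \<in> E}. d)"
    using regular_graph_edge(2)[OF E] by (intro sum.cong refl card_neighbours[OF E]) auto
  finally show "card {(x, y). {a, x} \<in> E \<and> {x, y} \<in> E} = d * d"
    unfolding eq using card_neighbours[OF E a] by simp
qed

text \<open>
  Double counting of switches between graphs with \<open>b\<close> and with \<open>b + 2\<close> boundary edges.
  From a graph with \<open>b\<close> boundary edges one may choose any of \<open>d s - b\<close> arcs inside \<open>U\<close> and,
  for each, any of the \<open>d (n - s) - b\<close> arcs outside \<open>U\<close> except at most \<open>2 d\<^sup>2\<close> that would
  create a double edge. Conversely a switch is undone by naming two boundary edges of the result,
  which leaves at most \<open>(b + 2)\<^sup>2\<close> possibilities. Natural subtraction only weakens the left-hand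
  side when a difference would be negative.
\<close>

lemma switching_inequality:
  fixes n d b :: nat and U :: "nat set"
  assumes U: "U \<subseteq> {..<n}"
  defines "s \<equiv> card U"
  shows "card (graphs_with_boundary n d U b) * ((d * s - b) * (d * (n - s) - b - 2 * (d * d)))
     \<le> card (graphs_with_boundary n d U (b + 2)) * ((b + 2) * (b + 2))"
proof -
  define W where "W = {..<n} - U"
  have finU: "finite U" "finite W" using U by (auto simp: W_def intro: finite_subset)
  define good where "good E = Sigma (arcs E U U)
      (\<lambda>(a, b). {(x, y) \<in> arcs E W W. {a, x} \<notin> E \<and> {b, y} \<notin> E})" for E
  \<comment> \<open>The data of the inverse switches: the boundary edges \<open>ax\<close> and \<open>by\<close> to be removed.\<close>
  define moves where "moves E = {((a, b), (x, y)). (a, x) \<in> arcs E U W \<and> (b, y) \<in> arcs E U W}" for E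
  define P where "P = Sigma (graphs_with_boundary n d U b) good"
  define Q where "Q = Sigma (graphs_with_boundary n d U (b + 2)) moves"
  define \<Phi> where "\<Phi> = (\<lambda>(E, ((a, b), (x, y))). (switch E a b x y, ((a, b), (x :: nat, y :: nat))))"
  have fin_good: "finite (good E)" for E
    unfolding good_def using finU
    by (intro finite_SigmaI finite_arcs)
       (auto intro: finite_subset[OF _ finite_arcs[of W W E]])
  have moves_eq: "moves E = (\<lambda>((a, x), (b, y)). ((a, b), (x, y))) ` (arcs E U W \<times> arcs E U W)" for E
  proof (intro subset_antisym subsetI)
    fix p assume "p \<in> moves E"
    then obtain a b x y where "p = ((a, b), (x, y))" "(a, x) \<in> arcs E U W" "(b, y) \<in> arcs E U W"
      by (auto simp: moves_def)
    then show "p \<in> (\<lambda>((a, x), (b, y)). ((a, b), (x, y))) ` (arcs E U W \<times> arcs E U W)"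
      by (intro image_eqI[of _ _ "((a, x), (b, y))"]) simp_all
  qed (auto simp: moves_def)
  have card_moves: "card (moves E) = card (arcs E U W) * card (arcs E U W)" for E
  proof -
    have "inj_on (\<lambda>((a, x), (b, y)). ((a, b), (x, y))) (arcs E U W \<times> arcs E U W)"
      by (auto simp: inj_on_def)
    then show ?thesis unfolding moves_eq by (simp add: card_image card_cartesian_product)
  qed
  have fin_moves: "finite (moves E)" for E
    unfolding moves_eq using finU finite_arcs by blast
  have finQ: "finite Q"
    unfolding Q_def using finite_graphs_with_boundary fin_moves by (intro finite_SigmaI)
  have cardQ: "card Q = card (graphs_with_boundary n d U (b + 2)) * ((b + 2) * (b + 2))"
  proof -
    have "card Q = (\<Sum>E\<in>graphs_with_boundary n d U (b + 2). card (moves E))"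
      unfolding Q_def using finite_graphs_with_boundary fin_moves by (intro card_SigmaI) auto
    also have "\<dots> = (\<Sum>E\<in>graphs_with_boundary n d U (b + 2). (b + 2) * (b + 2))"
      by (intro sum.cong refl)
         (auto simp: card_moves graphs_with_boundary_def W_def card_edge_boundary[OF _ U])
    finally show ?thesis by simp
  qed
  have good_ge: "(d * s - b) * (d * (n - s) - b - 2 * (d * d)) \<le> card (good E)"
    if "E \<in> graphs_with_boundary n d U b" for E
  proof -
    have E: "E \<in> regular_graphs n d" and Eb: "card (edge_boundary E U) = b"
      using that by (auto simp: graphs_with_boundary_def)
    have UW: "card (arcs E U W) = b"
      using card_edge_boundary[OF E U] Eb by (simp add: W_def)
    have UU: "card (arcs E U U) = d * s - b"
      using card_arcs_split[OF E U U] UW by (simp add: W_def s_def)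
    have "card W = n - s" using U finU by (simp add: W_def s_def card_Diff_subset)
    moreover have "card (arcs E W U) + card (arcs E W W) = d * card W"
      using card_arcs_split[OF E _ U, of W] by (auto simp: W_def)
    ultimately have WW: "card (arcs E W W) = d * (n - s) - b"
      using card_arcs_swap[of E U W] UW by simp
    have fib: "d * (n - s) - b - 2 * (d * d)
        \<le> card {(x, y) \<in> arcs E W W. {a, x} \<notin> E \<and> {b', y} \<notin> E}" (is "_ \<le> card ?G")
      if "(a, b') \<in> arcs E U U" for a b'
    proof -
      have ab: "a < n" "b' < n" using that U by (auto simp: arcs_def)
      define B1 where "B1 = {(x, y). {a, x} \<in> E \<and> {x, y} \<in> E}"
      define B2 where "B2 = {(y, x). {b', y} \<in> E \<and> {y, x} \<in> E}"
      have B1: "finite B1" "card B1 = d * d"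
        unfolding B1_def by (rule card_two_step_walks[OF E ab(1)])+
      have B2: "finite B2" "card B2 = d * d"
        unfolding B2_def by (rule card_two_step_walks[OF E ab(2)])+
      \<comment> \<open>The second family is swapped because \<open>by\<close> is forbidden through \<open>y\<close>, not \<open>x\<close>.\<close>
      have "arcs E W W \<subseteq> ?G \<union> (B1 \<union> prod.swap ` B2)"
        by (auto simp: B1_def B2_def arcs_def insert_commute image_iff)
      moreover have finG: "finite ?G"
        by (rule finite_subset[OF _ finite_arcs[OF finU(2) finU(2), of E]]) auto
      ultimately have "card (arcs E W W) \<le> card (?G \<union> (B1 \<union> prod.swap ` B2))"
        using B1 B2 by (intro card_mono) auto
      also have "\<dots> \<le> card ?G + card (B1 \<union> prod.swap ` B2)" by (rule card_Un_le)
      also have "\<dots> \<le> card ?G + (card B1 + card (prod.swap ` B2))"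
        by (intro add_left_mono card_Un_le)
      also have "\<dots> = card ?G + 2 * (d * d)" using B1 B2 by (simp add: card_image)
      finally show ?thesis using WW by simp
    qed
    have "card (good E) = (\<Sum>p\<in>arcs E U U.
        card (case p of (a, b) \<Rightarrow> {(x, y) \<in> arcs E W W. {a, x} \<notin> E \<and> {b, y} \<notin> E}))"
      unfolding good_def using finU
      by (intro card_SigmaI finite_arcs)
         (auto intro: finite_subset[OF _ finite_arcs[of W W E]])
    moreover have "(\<Sum>p\<in>arcs E U U. d * (n - s) - b - 2 * (d * d)) \<le> \<dots>"
      using fib by (intro sum_mono) auto
    ultimately show ?thesis using UU by simp
  qed
  have "card (graphs_with_boundary n d U b) * ((d * s - b) * (d * (n - s) - b - 2 * (d * d)))
      = (\<Sum>E\<in>graphs_with_boundary n d U b. (d * s - b) * (d * (n - s) - b - 2 * (d * d)))"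
    by simp
  also have "\<dots> \<le> (\<Sum>E\<in>graphs_with_boundary n d U b. card (good E))"
    using good_ge by (intro sum_mono) auto
  also have "\<dots> = card P"
    unfolding P_def using finite_graphs_with_boundary fin_good by (subst card_SigmaI) auto
  also have "\<dots> \<le> card Q"
  proof (rule card_inj_on_le[OF _ _ finQ])
    have PE: "E \<in> regular_graphs n d" "card (edge_boundary E U) = b"
        "a \<in> U" "c \<in> U" "x \<notin> U" "y \<notin> U" "x \<in> W" "y \<in> W"
        "{a, c} \<in> E" "{x, y} \<in> E" "{a, x} \<notin> E" "{c, y} \<notin> E"
      if "(E, (a, c), (x, y)) \<in> P" for E a c x y
      using that by (auto simp: P_def good_def arcs_def graphs_with_boundary_def W_def)
    show "inj_on \<Phi> P"
    proof (rule inj_onI)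
      fix t t' assume tt: "t \<in> P" "t' \<in> P" "\<Phi> t = \<Phi> t'"
      obtain E a c x y where t: "t = (E, (a, c), (x, y))" by (metis surj_pair)
      obtain F a' c' x' y' where t': "t' = (F, (a', c'), (x', y'))" by (metis surj_pair)
      have p: "(E, (a, c), (x, y)) \<in> P" and q: "(F, (a', c'), (x', y')) \<in> P"
        and eq: "\<Phi> (E, (a, c), (x, y)) = \<Phi> (F, (a', c'), (x', y'))"
        using tt t t' by simp_all
      from eq have same: "a' = a" "c' = c" "x' = x" "y' = y" "switch E a c x y = switch F a c x y"
        by (auto simp: \<Phi>_def)
      \<comment> \<open>Since all four edges are recorded, the graph can be recovered from its switch.\<close>
      have inv: "E = (switch E a c x y - {{a, x}, {c, y}}) \<union> {{a, c}, {x, y}}"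
        if "(E, (a, c), (x, y)) \<in> P" for E
        using PE[OF that] unfolding switch_def by blast
      have "E = F" using inv[OF p] inv[of F] q same by simp
      then show "t = t'" using same t t' by simp
    qed
    show "\<Phi> ` P \<subseteq> Q"
    proof clarify
      fix E a c x y F a' c' x' y'
      assume p: "(E, (a, c), (x, y)) \<in> P" and eq: "(F, (a', c'), (x', y')) = \<Phi> (E, (a, c), (x, y))"
      note h = PE[OF p]
      have "switch E a c x y \<in> graphs_with_boundary n d U (b + 2)"
        using switch_regular[of E n d a U c x y] card_edge_boundary_switch[of E n d a U c x y] h
        by (simp add: graphs_with_boundary_def)
      moreover have "((a, c), (x, y)) \<in> moves (switch E a c x y)"
        using h by (auto simp: moves_def arcs_def switch_def)
      ultimately show "(F, (a', c'), (x', y')) \<in> Q" using eq by (simp add: \<Phi>_def Q_def)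
    qed
  qed
  finally show ?thesis using cardQ by simp
qed

section \<open>Regular graphs with a small boundary are rare\<close>

lemma real_diff_le: "real a - real b \<le> real (a - b)"
  by (cases "b \<le> a") (auto simp: of_nat_diff)

text \<open>
  The switching inequality as a ratio. Let \<open>s = card U\<close>. If \<open>b + 2 \<le> (1 - c) d s\<close>, there are at
  least \<open>c d s\<close> arcs inside \<open>U\<close>. Outside there are at least
  \<open>d n - (2 - c) d s \<ge> d n (1 - 2 u + c u)\<close>, which exceeds \<open>d n (1 - u)\<^sup>2\<close> by
  \<open>d n u (c - u)\<close>; for large \<open>n\<close> this surplus pays for the \<open>2 d\<^sup>2\<close> forbidden arcs. As
  \<open>(1 - u)\<^sup>2 \<ge> (1 - c)\<^sup>2\<close>, the numerical factor on the left of the switching inequality is at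
  least \<open>c n / s\<close> times the one on the right:
  \<open>c d s \<cdot> d n (1 - c)\<^sup>2 = (c n / s) \<cdot> ((1 - c) d s)\<^sup>2\<close>.
\<close>

lemma boundary_step:
  fixes u c :: real
  assumes U: "U \<subseteq> {..<n}" and u: "0 < u" "u < c"
    and size: "real (card U) \<le> u * real n"
    and n: "2 * real d \<le> u * (c - u) * real n"
    and b: "real (b + 2) \<le> (1 - c) * (real d * real (card U))"
  shows "real (card (graphs_with_boundary n d U b))
    \<le> real (card U) / (real n * c) * real (card (graphs_with_boundary n d U (b + 2)))"
proof -
  define s where "s = card U"
  define X where "X = real (card (graphs_with_boundary n d U b))"
  define Y where "Y = real (card (graphs_with_boundary n d U (b + 2)))"
  have XY: "X \<ge> 0" "Y \<ge> 0" by (simp_all add: X_def Y_def)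
  have pos: "(1 - c) * (real d * real s) > 0" using b by (simp add: s_def)
  then have ds: "real d * real s > 0"
    by (metis linorder_neqE_linordered_idom mult_eq_0_iff not_less of_nat_0_le_iff of_nat_mult less_irrefl)
  then have d: "real d > 0" and s: "real s > 0" by (auto simp: zero_less_mult_iff)
  have c: "1 - c > 0" using pos ds by (metis zero_less_mult_pos2)
  have npos: "real n > 0" using size s u unfolding s_def
    by (metis less_le_trans zero_less_mult_pos)
  have "u \<le> 1" using c u by simp
  have sn: "s \<le> n" using size \<open>u \<le> 1\<close> u mult_right_mono[of u 1 "real n"] by (simp add: s_def)
  have inside: "c * (real d * real s) \<le> real (d * s - b)"
    using b real_diff_le[of "d * s" b] by (simp add: s_def algebra_simps)
  have outside: "real d * real n * (1 - c)\<^sup>2 \<le> real (d * (n - s) - b - 2 * (d * d))"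
  proof -
    have "(2 - c) * real s \<le> (2 - c) * (u * real n)"
      using size c by (intro mult_left_mono) (auto simp: s_def)
    then have "real d * ((2 - c) * real s) \<le> real d * ((2 - c) * (u * real n))"
      using d by simp
    moreover have "real d * (2 * real d) \<le> real d * (u * (c - u) * real n)"
      using n d by simp
    moreover have "real d * real n * (1 - c)\<^sup>2 \<le> real d * real n * (1 - u)\<^sup>2"
      using c u by (intro mult_left_mono power_mono) auto
    ultimately have "real d * real n * (1 - c)\<^sup>2
        \<le> real d * (real n - real s) - real b - 2 * (real d * real d)"
      using b unfolding s_def by (simp add: power2_eq_square algebra_simps)
    also have "\<dots> = real d * real (n - s) - real b - 2 * (real d * real d)"
      using sn by (simp add: of_nat_diff)
    also have "\<dots> \<le> real (d * (n - s) - b - 2 * (d * d))"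
      using real_diff_le[of "d * (n - s) - b" "2 * (d * d)"] real_diff_le[of "d * (n - s)" b] by simp
    finally show ?thesis .
  qed
  have "X * ((c * (real d * real s)) * (real d * real n * (1 - c)\<^sup>2))
      \<le> X * (real (d * s - b) * real (d * (n - s) - b - 2 * (d * d)))"
    using inside outside XY u c d npos s by (intro mult_left_mono mult_mono) auto
  also have "\<dots> \<le> Y * real ((b + 2) * (b + 2))"
    using switching_inequality[OF U, of d b] unfolding X_def Y_def s_def
    by (simp only: flip: of_nat_mult of_nat_le_iff)
  also have "\<dots> \<le> Y * (((1 - c) * (real d * real s)) * ((1 - c) * (real d * real s)))"
    using b XY pos unfolding of_nat_mult s_def by (intro mult_left_mono mult_mono) auto
  finally have "(X * (c * real n)) * (real d * real d * real s * (1 - c)\<^sup>2)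
      \<le> (Y * real s) * (real d * real d * real s * (1 - c)\<^sup>2)"
    by (simp add: power2_eq_square algebra_simps)
  then have "X * (c * real n) \<le> Y * real s"
    using d s c by (simp add: mult_le_cancel_right)
  then have "X \<le> real s / (real n * c) * Y"
    using npos u by (simp add: field_simps)
  then show ?thesis by (simp add: X_def Y_def s_def)
qed

lemma boundary_steps:
  fixes u c :: real
  assumes U: "U \<subseteq> {..<n}" and u: "0 < u" "u < c"
    and size: "real (card U) \<le> u * real n"
    and n: "2 * real d \<le> u * (c - u) * real n"
    and b: "real (b + 2 * j) \<le> (1 - c) * (real d * real (card U))"
  shows "real (card (graphs_with_boundary n d U b))
    \<le> (real (card U) / (real n * c)) ^ j * real (card (graphs_with_boundary n d U (b + 2 * j)))"
  using b
proof (induction j)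
  case (Suc j)
  define \<rho> where "\<rho> = real (card U) / (real n * c)"
  have \<rho>: "\<rho> \<ge> 0" using u by (simp add: \<rho>_def)
  have "real (card (graphs_with_boundary n d U b))
      \<le> \<rho> ^ j * real (card (graphs_with_boundary n d U (b + 2 * j)))"
    using Suc unfolding \<rho>_def by simp
  also have "\<dots> \<le> \<rho> ^ j * (\<rho> * real (card (graphs_with_boundary n d U (b + 2 * j + 2))))"
    using boundary_step[OF U u size n, of "b + 2 * j"] Suc.prems \<rho>
    unfolding \<rho>_def by (intro mult_left_mono) auto
  finally have "real (card (graphs_with_boundary n d U b))
      \<le> \<rho> ^ j * (\<rho> * real (card (graphs_with_boundary n d U (b + 2 * j + 2))))" .
  moreover have "b + 2 * j + 2 = b + 2 * Suc j" by simp
  ultimately show ?case unfolding \<rho>_def by (simp only: power_Suc2 mult.assoc)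
qed simp

text \<open>
  A deficit of \<open>\<delta> d s\<close> boundary edges leaves room for \<open>m s\<close> switches, \<open>2 m \<le> \<delta> d\<close>, each of
  which gains the factor of the preceding lemmas. Shifting every boundary size by the same
  \<open>2 m s\<close> keeps the classes disjoint, so the shifted classes together number at most all
  regular graphs.
\<close>

lemma card_small_boundary:
  fixes u c \<delta> :: real
  assumes U: "U \<subseteq> {..<n}" and u: "0 < u" "u < c"
    and size: "real (card U) \<le> u * real n"
    and n: "2 * real d \<le> u * (c - u) * real n"
    and m: "2 * real m \<le> \<delta> * real d"
  shows "real (card {E \<in> regular_graphs n d.
            real (card (edge_boundary E U)) < (1 - c - \<delta>) * real d * real (card U)})
    \<le> (real (card U) / (real n * c)) ^ (m * card U) * real (card (regular_graphs n d))"
proof -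
  define s where "s = card U"
  define \<rho> where "\<rho> = real s / (real n * c)"
  define T where "T = {b. real b < (1 - c - \<delta>) * real d * real s}"
  have \<rho>: "\<rho> \<ge> 0" using u by (simp add: \<rho>_def)
  have finT: "finite T"
  proof (rule finite_subset)
    show "T \<subseteq> {..nat \<lceil>(1 - c - \<delta>) * real d * real s\<rceil>}"
      by (auto simp: T_def) linarith
  qed simp
  have step: "real (card (graphs_with_boundary n d U b))
      \<le> \<rho> ^ (m * s) * real (card (graphs_with_boundary n d U (b + 2 * (m * s))))"
    if "b \<in> T" for b
    unfolding \<rho>_def s_def
  proof (rule boundary_steps[OF U u size n])
    have "2 * real m * real s \<le> \<delta> * real d * real s"
      using m by (intro mult_right_mono) auto
    then show "real (b + 2 * (m * card U)) \<le> (1 - c) * (real d * real (card U))"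
      using that unfolding T_def s_def by (simp add: algebra_simps)
  qed
  have "{E \<in> regular_graphs n d. real (card (edge_boundary E U)) < (1 - c - \<delta>) * real d * real s}
      = (\<Union>b\<in>T. graphs_with_boundary n d U b)"
    by (auto simp: T_def graphs_with_boundary_def)
  then have "real (card {E \<in> regular_graphs n d.
        real (card (edge_boundary E U)) < (1 - c - \<delta>) * real d * real s})
      \<le> real (\<Sum>b\<in>T. card (graphs_with_boundary n d U b))"
    using card_UN_le[OF finT] by (metis of_nat_le_iff)
  also have "\<dots> \<le> (\<Sum>b\<in>T. \<rho> ^ (m * s) * real (card (graphs_with_boundary n d U (b + 2 * (m * s)))))"
    unfolding of_nat_sum by (intro sum_mono step)
  also have "\<dots> = \<rho> ^ (m * s) * real (\<Sum>b\<in>T. card (graphs_with_boundary n d U (b + 2 * (m * s))))"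
    by (simp add: sum_distrib_left)
  also have "(\<Sum>b\<in>T. card (graphs_with_boundary n d U (b + 2 * (m * s))))
      = card (\<Union>b\<in>T. graphs_with_boundary n d U (b + 2 * (m * s)))"
    using finT finite_graphs_with_boundary
    by (intro card_UN_disjoint[symmetric]) (auto simp: graphs_with_boundary_def)
  also have "\<rho> ^ (m * s) * real (card (\<Union>b\<in>T. graphs_with_boundary n d U (b + 2 * (m * s))))
      \<le> \<rho> ^ (m * s) * real (card (regular_graphs n d))"
    using \<rho> finite_regular_graphs
    by (intro mult_left_mono of_nat_mono card_mono) (auto simp: graphs_with_boundary_def)
  finally show ?thesis by (simp add: \<rho>_def s_def)
qed

text \<open>
  The left-hand side is one term of the binomial expansion of \<open>(1 + s / n) ^ n \<le> exp s\<close>.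
\<close>

lemma binomial_le_exp:
  assumes "n > 0"
  shows "real (n choose s) * (real s / real n) ^ s \<le> exp (real s)"
proof (cases "s \<le> n")
  case True
  have "real (n choose s) * (real s / real n) ^ s
      \<le> (\<Sum>k\<le>n. real (n choose k) * (real s / real n) ^ k)"
    using True by (intro member_le_sum[of s "{..n}" "\<lambda>k. real (n choose k) * (real s / real n) ^ k"]) auto
  also have "\<dots> = (real s / real n + 1) ^ n"
    by (simp add: binomial_ring)
  also have "\<dots> \<le> exp (real s / real n) ^ n"
    using exp_ge_add_one_self[of "real s / real n"] by (intro power_mono) (auto simp: add.commute)
  also have "\<dots> = exp (real s)" using assms by (simp flip: exp_of_nat_mult)
  finally show ?thesis .
qed (simp add: binomial_eq_0)

lemma sum_over_pow2_le: "(\<Sum>s=1..N. real s / 2 ^ s) \<le> 2"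
proof -
  have "(\<Sum>s=1..N. real s / 2 ^ s) = 2 - (real N + 2) / 2 ^ N"
    by (induction N) (auto simp: field_simps)
  then show ?thesis by (simp add: divide_nonneg_nonneg)
qed

definition weak_graphs :: "real \<Rightarrow> nat \<Rightarrow> nat \<Rightarrow> real \<Rightarrow> nat set set set" where
  "weak_graphs u n d l = {E \<in> regular_graphs n d. \<exists>U. U \<subseteq> {..<n} \<and> U \<noteq> {} \<and>
     real (card U) \<le> u * real n \<and> real (card (edge_boundary E U)) < l * real (card U)}"

text \<open>
  Union bound over all \<open>U\<close>. With \<open>\<rho> = s / (n c)\<close>, the sets of size \<open>s\<close> contribute at most
  \<open>(n choose s) \<rho> ^ ((m + 2) s)\<close>. One factor \<open>\<rho> ^ s\<close> cancels the binomial coefficient up to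
  \<open>(exp 1 / c) ^ s\<close>; the factor \<open>\<rho> ^ (m s) \<le> (u / c) ^ (m s)\<close> beats this constant, leaving at most
  \<open>2 ^ (- s)\<close>; and the last factor \<open>\<rho> ^ s \<le> \<rho>\<close> supplies the decay in \<open>n\<close>, uniformly in
  small and large \<open>s\<close>.
\<close>

lemma card_weak_graphs:
  fixes u c \<delta> :: real
  assumes u: "0 < u" "u < c" and npos: "n > 0"
    and n: "2 * real d \<le> u * (c - u) * real n"
    and m: "2 * real (m + 2) \<le> \<delta> * real d"
    and q: "exp 1 / c * (u / c) ^ m \<le> 1 / 2"
  shows "real (card (weak_graphs u n d ((1 - c - \<delta>) * real d)))
    \<le> 2 / (real n * c) * real (card (regular_graphs n d))"
proof -
  define R where "R = real (card (regular_graphs n d))"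
  define S where "S = {s \<in> {1..n}. real s \<le> u * real n}"
  define \<U> where "\<U> s = {U. U \<subseteq> {..<n} \<and> card U = s}" for s
  define B where "B U = {E \<in> regular_graphs n d.
      real (card (edge_boundary E U)) < (1 - c - \<delta>) * real d * real (card U)}" for U
  define \<rho> where "\<rho> s = real s / (real n * c)" for s
  have fin: "finite S" "finite (\<U> s)" for s
    by (auto simp: S_def \<U>_def)
  have finB: "finite (B U)" for U using finite_regular_graphs by (simp add: B_def)
  have "weak_graphs u n d ((1 - c - \<delta>) * real d) \<subseteq> (\<Union>s\<in>S. \<Union>U\<in>\<U> s. B U)"
  proof
    fix E assume "E \<in> weak_graphs u n d ((1 - c - \<delta>) * real d)"
    then obtain U where E: "E \<in> regular_graphs n d" and U: "U \<subseteq> {..<n}" "U \<noteq> {}"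
        "real (card U) \<le> u * real n"
        "real (card (edge_boundary E U)) < (1 - c - \<delta>) * real d * real (card U)"
      by (auto simp: weak_graphs_def)
    have "finite U" using U(1) finite_subset by blast
    then have "card U > 0" using U(2) by (simp add: card_gt_0_iff)
    moreover have "card U \<le> n" using card_mono[OF _ U(1)] by simp
    ultimately have "card U \<in> S" using U by (simp add: S_def)
    then show "E \<in> (\<Union>s\<in>S. \<Union>U\<in>\<U> s. B U)" using E U by (auto simp: \<U>_def B_def)
  qed
  then have "card (weak_graphs u n d ((1 - c - \<delta>) * real d)) \<le> card (\<Union>s\<in>S. \<Union>U\<in>\<U> s. B U)"
    using fin finB by (intro card_mono) auto
  also have "\<dots> \<le> (\<Sum>s\<in>S. card (\<Union>U\<in>\<U> s. B U))" by (rule card_UN_le[OF fin(1)])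
  also have "\<dots> \<le> (\<Sum>s\<in>S. \<Sum>U\<in>\<U> s. card (B U))" by (intro sum_mono card_UN_le fin)
  finally have "real (card (weak_graphs u n d ((1 - c - \<delta>) * real d)))
      \<le> (\<Sum>s\<in>S. \<Sum>U\<in>\<U> s. real (card (B U)))"
    by (simp flip: of_nat_sum)
  also have "\<dots> \<le> (\<Sum>s\<in>S. \<Sum>U\<in>\<U> s. \<rho> s ^ ((m + 2) * s) * R)"
  proof (intro sum_mono)
    fix s U assume "s \<in> S" "U \<in> \<U> s"
    then show "real (card (B U)) \<le> \<rho> s ^ ((m + 2) * s) * R"
      using card_small_boundary[of U n u c d "m + 2" \<delta>] u n m
      unfolding B_def R_def \<rho>_def \<U>_def S_def by simp
  qed
  also have "\<dots> = (\<Sum>s\<in>S. real (n choose s) * \<rho> s ^ ((m + 2) * s) * R)"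
    using n_subsets[of "{..<n}"] by (simp add: \<U>_def mult.assoc)
  also have "\<dots> \<le> (\<Sum>s\<in>S. 1 / (real n * c) * (real s / 2 ^ s) * R)"
  proof (intro sum_mono mult_right_mono)
    fix s assume "s \<in> S"
    then have s: "1 \<le> s" "real s \<le> u * real n" by (auto simp: S_def)
    have \<rho>0: "0 \<le> \<rho> s" using u by (simp add: \<rho>_def)
    have \<rho>q: "\<rho> s \<le> u / c" using s u npos by (simp add: \<rho>_def field_simps)
    have "u / c \<le> 1" using u by simp
    have "\<rho> s ^ ((m + 2) * s) = (\<rho> s ^ (m + 2)) ^ s" by (rule power_mult)
    also have "\<dots> = (real s / real n * (1 / c * \<rho> s ^ m * \<rho> s)) ^ s"
      by (simp add: \<rho>_def power_add power2_eq_square mult_ac)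
    also have "\<dots> = (real s / real n) ^ s * (1 / c * \<rho> s ^ m * \<rho> s) ^ s"
      by (rule power_mult_distrib)
    finally have "real (n choose s) * \<rho> s ^ ((m + 2) * s)
        = (real (n choose s) * (real s / real n) ^ s) * (1 / c * \<rho> s ^ m * \<rho> s) ^ s" by simp
    also have "\<dots> \<le> exp (real s) * (1 / c * \<rho> s ^ m * \<rho> s) ^ s"
      using binomial_le_exp[OF npos] \<rho>0 u by (intro mult_right_mono) auto
    also have "\<dots> = (exp 1 / c * \<rho> s ^ m * \<rho> s) ^ s"
      by (simp add: exp_of_nat_mult[of s 1, simplified] power_mult_distrib power_divide)
    also have "\<dots> \<le> (1 / 2 * \<rho> s) ^ s"
    proof (intro power_mono mult_right_mono)
      have "exp 1 / c * \<rho> s ^ m \<le> exp 1 / c * (u / c) ^ m"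
        using \<rho>0 \<rho>q u by (intro mult_left_mono power_mono) auto
      then show "exp 1 / c * \<rho> s ^ m \<le> 1 / 2" using q by (rule order_trans)
    qed (use \<rho>0 u in auto)
    also have "\<dots> = \<rho> s ^ s / 2 ^ s" by (simp add: power_divide)
    also have "\<dots> \<le> \<rho> s / 2 ^ s"
      using power_decreasing[OF s(1), of "\<rho> s"] \<rho>0 \<rho>q \<open>u / c \<le> 1\<close>
      by (intro divide_right_mono) auto
    also have "\<dots> = 1 / (real n * c) * (real s / 2 ^ s)" by (simp add: \<rho>_def)
    finally show "real (n choose s) * \<rho> s ^ ((m + 2) * s) \<le> 1 / (real n * c) * (real s / 2 ^ s)" .
  qed (simp add: R_def)
  also have "\<dots> = 1 / (real n * c) * (\<Sum>s\<in>S. real s / 2 ^ s) * R"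
    by (simp add: sum_distrib_left sum_distrib_right)
  also have "\<dots> \<le> 1 / (real n * c) * (\<Sum>s=1..n. real s / 2 ^ s) * R"
    using u by (intro mult_left_mono mult_right_mono sum_mono2) (auto simp: S_def R_def)
  also have "\<dots> \<le> 1 / (real n * c) * 2 * R"
    using u sum_over_pow2_le by (intro mult_left_mono mult_right_mono) (auto simp: R_def)
  finally show ?thesis by (simp add: R_def)
qed

section \<open>Expansion of random regular graphs\<close>

lemma edge_expansion_ge_iff:
  assumes "u * real n \<ge> 1"
  shows "l \<le> edge_expansion u n E \<longleftrightarrow>
     (\<forall>U. U \<subseteq> {..<n} \<and> U \<noteq> {} \<and> real (card U) \<le> u * real n \<longrightarrow>
        l * real (card U) \<le> real (card (edge_boundary E U)))"
proof -
  define \<U> where "\<U> = {U. U \<subseteq> {..<n} \<and> U \<noteq> {} \<and> real (card U) \<le> u * real n}"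
  define f where "f U = real (card (edge_boundary E U)) / real (card U)" for U
  have n: "n > 0" using assms by (cases n) auto
  have "{0} \<in> \<U>" using assms n by (auto simp: \<U>_def)
  moreover have "finite \<U>" by (rule finite_subset[of _ "Pow {..<n}"]) (auto simp: \<U>_def)
  moreover have "edge_expansion u n E = Min (f ` \<U>)"
    unfolding edge_expansion_def f_def \<U>_def by (rule arg_cong[of _ _ Min]) blast
  ultimately have "l \<le> edge_expansion u n E \<longleftrightarrow> (\<forall>U\<in>\<U>. l \<le> f U)"
    by (subst \<open>edge_expansion u n E = Min (f ` \<U>)\<close>, subst Min_ge_iff) auto
  also have "\<dots> \<longleftrightarrow> (\<forall>U\<in>\<U>. l * real (card U) \<le> real (card (edge_boundary E U)))"
  proof (intro ball_cong refl)
    fix U assume "U \<in> \<U>"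
    then have "finite U" "U \<noteq> {}" by (auto simp: \<U>_def intro: finite_subset)
    then have "real (card U) > 0" by (simp add: card_gt_0_iff)
    then show "l \<le> f U \<longleftrightarrow> l * real (card U) \<le> real (card (edge_boundary E U))"
      by (simp add: f_def pos_le_divide_eq)
  qed
  finally show ?thesis by (auto simp: \<U>_def)
qed

text \<open>
  Circulant graphs: vertices are joined when their difference modulo \<open>n\<close> is at most
  \<open>d div 2\<close> in absolute value or, for odd \<open>d\<close>, equal to \<open>n / 2\<close>. Nonemptiness is needed for the
  uniform distribution to be what it should be.
\<close>

lemma regular_graphs_nonempty:
  assumes d: "d < n" and even: "even (d * n)"
  shows "regular_graphs n d \<noteq> {}"
proof -
  define k where "k = d div 2"
  define M where "M = (if odd d then {n div 2} else {})"
  define S where "S = {1..k} \<union> {n - k..<n} \<union> M"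
  define E where "E = {{a, b} | a b. a < b \<and> b < n \<and> b - a \<in> S}"
  have edge: "{a, b} \<in> E" if "a < b" "b < n" "b - a \<in> S" for a b
    unfolding E_def using that by blast
  have half: "n = 2 * (n div 2)" "d = 2 * k + 1" "k < n div 2" "n div 2 < n - k" if "odd d"
    using that even d by (auto simp: k_def)
  have k: "2 * k \<le> d" by (simp add: k_def)
  have S: "t \<ge> 1" "t < n" "n - t \<in> S" if "t \<in> S" for t
    using that d k half by (auto simp: S_def M_def split: if_splits)
  have cardS: "card S = d"
  proof -
    have "card S = card ({1..k} \<union> {n - k..<n}) + card M"
      unfolding S_def using half d k by (intro card_Un_disjoint) (auto simp: M_def)
    also have "card ({1..k} \<union> {n - k..<n}) = k + k"
      using d k by (subst card_Un_disjoint) auto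
    also have "card M = (if odd d then 1 else 0)" by (simp add: M_def)
    also have "k + k + (if odd d then 1 else 0) = d" unfolding k_def by presburger
    finally show ?thesis .
  qed
  have deg: "card {e \<in> E. v \<in> e} = d" if v: "v < n" for v
  proof -
    \<comment> \<open>The vertex \<open>v - t\<close> modulo \<open>n\<close>.\<close>
    define w where "w t = (if t \<le> v then v - t else v + n - t)" for t
    have "bij_betw (\<lambda>t. {v, w t}) S {e \<in> E. v \<in> e}"
      unfolding bij_betw_def
    proof
      have "w t = w t' \<Longrightarrow> t = t'" if "t \<in> S" "t' \<in> S" for t t'
        using S[OF that(1)] S[OF that(2)] v by (auto simp: w_def split: if_splits)
      moreover have "w t \<noteq> v" if "t \<in> S" for t
        using S[OF that] v by (auto simp: w_def)
      ultimately show "inj_on (\<lambda>t. {v, w t}) S"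
        by (auto simp: inj_on_def doubleton_eq_iff)
      show "(\<lambda>t. {v, w t}) ` S = {e \<in> E. v \<in> e}"
      proof (intro subset_antisym subsetI)
        fix e assume "e \<in> (\<lambda>t. {v, w t}) ` S"
        then obtain t where t: "t \<in> S" "e = {v, w t}" by auto
        show "e \<in> {e \<in> E. v \<in> e}"
        proof (cases "t \<le> v")
          case True
          then have "e = {v - t, v}" "v - t < v" "v - (v - t) = t"
            using t S(1)[OF t(1)] by (auto simp: w_def)
          then have "e \<in> E" using edge[of "v - t" v] t v by simp
          then show ?thesis using t by simp
        next
          case False
          then have "e = {v, v + n - t}" "v < v + n - t" "v + n - t < n" "v + n - t - v = n - t"
            using t S(2)[OF t(1)] by (auto simp: w_def)
          then have "e \<in> E" using edge[of v "v + n - t"] S(3)[OF t(1)] by simp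
          then show ?thesis using t by simp
        qed
      next
        fix e assume "e \<in> {e \<in> E. v \<in> e}"
        then obtain a b where ab: "e = {a, b}" "a < b" "b < n" "b - a \<in> S" "v = a \<or> v = b"
          by (auto simp: E_def)
        from ab(5) show "e \<in> (\<lambda>t. {v, w t}) ` S"
        proof
          assume "v = a"
          then have "w (n - (b - a)) = b" using ab by (auto simp: w_def)
          then show ?thesis using ab S(3)[OF ab(4)] \<open>v = a\<close>
            by (intro image_eqI[of _ _ "n - (b - a)"]) auto
        next
          assume "v = b"
          then have "w (b - a) = a" using ab by (auto simp: w_def)
          then show ?thesis using ab \<open>v = b\<close>
            by (intro image_eqI[of _ _ "b - a"]) auto
        qed
      qed
    qed
    then show ?thesis using cardS bij_betw_same_card by metis
  qed
  have "E \<subseteq> {e. e \<subseteq> {..<n} \<and> card e = 2}" by (auto simp: E_def)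
  then have "E \<in> regular_graphs n d" using deg by (simp add: regular_graphs_def)
  then show ?thesis by blast
qed

lemma prob_regular_graphs:
  assumes "d < n" and "even (d * n)"
  shows "measure_pmf.prob (pmf_of_set (regular_graphs n d)) A
     = real (card (regular_graphs n d \<inter> A)) / real (card (regular_graphs n d))"
  using measure_pmf_of_set[OF regular_graphs_nonempty[OF assms] finite_regular_graphs] .

lemma eventually_even_filter:
  fixes d :: nat
  assumes "\<And>n. n \<ge> N \<Longrightarrow> even (d * n) \<Longrightarrow> P n"
  shows "eventually P (at_top \<sqinter> principal {n. even (d * n)})"
  unfolding eventually_inf_principal eventually_at_top_linorder using assms by blast

lemma even_filter_nontrivial:
  fixes d :: nat
  shows "at_top \<sqinter> principal {n. even (d * n)} \<noteq> bot"
proof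
  assume "at_top \<sqinter> principal {n. even (d * n)} = (bot :: nat filter)"
  then have "eventually (\<lambda>_. False) (at_top \<sqinter> principal {n::nat. even (d * n)})" by simp
  then obtain N where "\<And>n::nat. n \<ge> N \<Longrightarrow> even (d * n) \<Longrightarrow> False"
    by (auto simp: eventually_inf_principal eventually_at_top_linorder)
  from this[of "2 * N"] show False by simp
qed

text \<open>
  A single vertex has \<open>d\<close> boundary edges. This bounds the set whose supremum defines
  \<^const>\<open>regular_expansion\<close>, without which that supremum would carry no information.
\<close>

lemma aas_expansion_le_degree:
  assumes u: "u > 0" and aas: "aas d (\<lambda>n E. l \<le> edge_expansion u n E)"
  shows "l \<le> real d"
proof (rule ccontr)
  assume l: "\<not> l \<le> real d"
  define N where "N = nat \<lceil>1 / u\<rceil> + d + 1"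
  have zero: "measure_pmf.prob (pmf_of_set (regular_graphs n d)) {E. l \<le> edge_expansion u n E} = 0"
    if n: "n \<ge> N" and even: "even (d * n)" for n
  proof -
    have "real n \<ge> 1 / u" using n unfolding N_def by linarith
    then have un: "u * real n \<ge> 1" using u by (simp add: field_simps)
    have dn: "d < n" using n by (simp add: N_def)
    have "regular_graphs n d \<inter> {E. l \<le> edge_expansion u n E} = {}"
    proof (rule ccontr)
      assume "\<not> ?thesis"
      then obtain E where E: "E \<in> regular_graphs n d" and "l \<le> edge_expansion u n E" by auto
      then have "l * real (card {0::nat}) \<le> real (card (edge_boundary E {0}))"
        using dn un unfolding edge_expansion_ge_iff[OF un] by (metis One_nat_def
            card.empty card.insert empty_iff empty_not_insert finite.emptyI gr_zeroI
            lessThan_iff not_less_zero of_nat_1 singletonD subsetI)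
      moreover have "edge_boundary E {0} \<subseteq> {e \<in> E. 0 \<in> e}"
      proof
        fix e assume "e \<in> edge_boundary E {0}"
        then have "e \<in> E" "card (e \<inter> {0}) = 1" by (simp_all add: edge_boundary_def)
        then show "e \<in> {e \<in> E. 0 \<in> e}" by (cases "0 \<in> e") auto
      qed
      then have "card (edge_boundary E {0}) \<le> card {e \<in> E. 0 \<in> e}"
        using regular_graph_finite[OF E] by (intro card_mono) auto
      moreover have "card {e \<in> E. 0 \<in> e} = d"
        using E dn by (auto simp: regular_graphs_def)
      ultimately show False using l by simp
    qed
    then show ?thesis by (simp add: prob_regular_graphs[OF dn even])
  qed
  have "((\<lambda>n. measure_pmf.prob (pmf_of_set (regular_graphs n d)) {E. l \<le> edge_expansion u n E})
      \<longlongrightarrow> 0) (at_top \<sqinter> principal {n. even (d * n)})"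
    by (rule tendsto_eventually, rule eventually_even_filter[of N], rule zero)
  then have "(0::real) = 1"
    using aas tendsto_unique[OF even_filter_nontrivial] unfolding aas_def by blast
  then show False by simp
qed

lemma regular_expansion_ge:
  assumes "u > 0" and "aas d (\<lambda>n E. l \<le> edge_expansion u n E)"
  shows "l \<le> regular_expansion u d"
  unfolding regular_expansion_def
proof (rule cSup_upper)
  show "bdd_above {l. aas d (\<lambda>n E. l \<le> edge_expansion u n E)}"
    by (rule bdd_aboveI[of _ "real d"]) (simp add: aas_expansion_le_degree[OF assms(1)])
qed (use assms(2) in blast)

text \<open>
  The slack \<open>\<epsilon>\<close> is split evenly. One half separates \<open>c = u + \<epsilon> / 2\<close> from \<open>u\<close>, which makes every
  switch gain at least the factor \<open>c / u > 1\<close>; the other half is spent on the number of switches,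
  which grows with \<open>d\<close>.
\<close>

lemma aas_expansion:
  fixes u \<epsilon> :: real
  assumes u: "0 < u" and \<epsilon>: "\<epsilon> > 0"
  shows "\<forall>\<^sub>F d in at_top. aas d (\<lambda>n E. (1 - u - \<epsilon>) * real d \<le> edge_expansion u n E)"
proof -
  define c where "c = u + \<epsilon> / 2"
  have uc: "0 < u" "u < c" "1 - u - \<epsilon> = 1 - c - \<epsilon> / 2" using u \<epsilon> by (auto simp: c_def)
  have "(\<lambda>m. exp 1 / c * (u / c) ^ m) \<longlonglongrightarrow> exp 1 / c * 0"
    using uc by (intro tendsto_mult tendsto_const LIMSEQ_power_zero) auto
  then have "\<forall>\<^sub>F m in sequentially. exp 1 / c * (u / c) ^ m < 1 / 2"
    by (intro order_tendstoD) auto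
  then obtain m where m: "exp 1 / c * (u / c) ^ m \<le> 1 / 2"
    by (auto simp: eventually_sequentially intro: less_imp_le)
  have "aas d (\<lambda>n E. (1 - u - \<epsilon>) * real d \<le> edge_expansion u n E)"
    if d: "d \<ge> nat \<lceil>4 * real (m + 2) / \<epsilon>\<rceil>" for d
    unfolding aas_def
  proof (rule tendsto_sandwich)
    define l where "l = (1 - u - \<epsilon>) * real d"
    define N where "N = nat \<lceil>1 / u\<rceil> + nat \<lceil>2 * real d / (u * (c - u))\<rceil> + d + 1"
    have "real d \<ge> 4 * real (m + 2) / \<epsilon>" using d by linarith
    then have md: "2 * real (m + 2) \<le> \<epsilon> / 2 * real d" using \<epsilon> by (simp add: field_simps)
    have bounds: "1 - 2 / (real n * c)
        \<le> measure_pmf.prob (pmf_of_set (regular_graphs n d)) {E. l \<le> edge_expansion u n E}"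
      if n: "n \<ge> N" and even: "even (d * n)" for n
    proof -
      have n': "real n \<ge> 1 / u" "real n \<ge> 2 * real d / (u * (c - u))" "d < n"
        using n unfolding N_def by linarith+
      have un: "u * real n \<ge> 1" using n' u by (simp add: field_simps)
      have nd: "2 * real d \<le> u * (c - u) * real n" using n' uc by (simp add: field_simps)
      define R where "R = regular_graphs n d"
      have R: "finite R" "card R > 0"
        using finite_regular_graphs regular_graphs_nonempty[OF n'(3) even]
        by (auto simp: R_def card_gt_0_iff)
      have "R = (R \<inter> {E. l \<le> edge_expansion u n E}) \<union> weak_graphs u n d l"
        unfolding weak_graphs_def R_def edge_expansion_ge_iff[OF un] by (auto simp: not_le)
      then have "card R \<le> card (R \<inter> {E. l \<le> edge_expansion u n E}) + card (weak_graphs u n d l)"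
        by (metis card_Un_le)
      moreover have "real (card (weak_graphs u n d l)) \<le> 2 / (real n * c) * real (card R)"
        unfolding l_def R_def uc(3) using uc n' nd md m by (intro card_weak_graphs) auto
      ultimately have "real (card R) \<le> real (card (R \<inter> {E. l \<le> edge_expansion u n E}))
          + 2 / (real n * c) * real (card R)" by linarith
      then have "(1 - 2 / (real n * c)) * real (card R)
          \<le> real (card (R \<inter> {E. l \<le> edge_expansion u n E}))" by (simp add: algebra_simps)
      then have "1 - 2 / (real n * c) \<le> real (card (R \<inter> {E. l \<le> edge_expansion u n E})) / real (card R)"
        using R by (simp add: pos_le_divide_eq)
      then show ?thesis unfolding prob_regular_graphs[OF n'(3) even] R_def .
    qed
    show "\<forall>\<^sub>F n in at_top \<sqinter> principal {n. even (d * n)}. 1 - 2 / (real n * c)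
        \<le> measure_pmf.prob (pmf_of_set (regular_graphs n d))
            {E. (1 - u - \<epsilon>) * real d \<le> edge_expansion u n E}"
      using bounds unfolding l_def by (rule eventually_even_filter)
    show "((\<lambda>n. 1 - 2 / (real n * c)) \<longlongrightarrow> 1) (at_top \<sqinter> principal {n. even (d * n)})"
    proof (rule tendsto_mono[OF inf_le1])
      have "(\<lambda>n. 1 - 2 / c * (1 / real n)) \<longlonglongrightarrow> 1 - 2 / c * 0"
        by (intro tendsto_diff tendsto_mult tendsto_const lim_const_over_n)
      then show "(\<lambda>n. 1 - 2 / (real n * c)) \<longlonglongrightarrow> 1" by (simp add: mult.commute)
    qed
  qed (auto simp: measure_pmf.prob_le_1)
  then show ?thesis unfolding eventually_at_top_linorder by blast
qed

lemma regular_expansion_asymptotic_lower: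
  fixes u :: real
  assumes u: "0 < u"
  shows "\<exists>\<epsilon> :: nat \<Rightarrow> real. \<epsilon> \<in> o[at_top](\<lambda>_. 1) \<and>
           (\<forall>\<^sub>F d in at_top. regular_expansion u d \<ge> real d * (1 - u + \<epsilon> d))"
proof (intro exI conjI)
  \<comment> \<open>Cutting off at \<open>0\<close> turns the lower bounds for the expansion into \<open>\<epsilon> \<longlonglongrightarrow> 0\<close>.\<close>
  define \<epsilon> where "\<epsilon> d = min 0 (regular_expansion u d / real d - (1 - u))" for d :: nat
  have "\<forall>\<^sub>F d in at_top. norm (\<epsilon> d) \<le> e * norm (1::real)" if "e > 0" for e
    using aas_expansion[OF u that] eventually_gt_at_top[of 0]
  proof eventually_elim
    case (elim d)
    then have "(1 - u - e) * real d \<le> regular_expansion u d"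
      using regular_expansion_ge[OF u] by blast
    then have "1 - u - e \<le> regular_expansion u d / real d"
      using elim by (simp add: pos_le_divide_eq)
    then show ?case using that by (auto simp: \<epsilon>_def)
  qed
  then show "\<epsilon> \<in> o[at_top](\<lambda>_. 1)" by (intro landau_o.smallI)
  show "\<forall>\<^sub>F d in at_top. regular_expansion u d \<ge> real d * (1 - u + \<epsilon> d)"
    using eventually_gt_at_top[of 0]
  proof eventually_elim
    case (elim d)
    have "1 - u + \<epsilon> d \<le> regular_expansion u d / real d" by (simp add: \<epsilon>_def)
    then show ?case using elim by (simp add: pos_le_divide_eq mult.commute)
  qed
qed

section \<open>The least root of the exponent\<close>

definition binary_entropy :: "real \<Rightarrow> real" where
  "binary_entropy u = - u * ln u - (1 - u) * ln (1 - u)"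

text \<open>
  With \<open>y = d v\<close> all multiples of \<open>ln d\<close> in
  \<^const>\<open>f_hat\<close> cancel, and what remains is \<open>d\<close> times this function plus a constant.
\<close>

definition rate :: "real \<Rightarrow> real \<Rightarrow> real" where
  "rate u v = - binary_entropy u - v * ln v
     - 1 / 2 * ((u - v) * ln (u - v) + (1 - u - v) * ln (1 - u - v))"

definition rate_deriv :: "real \<Rightarrow> real \<Rightarrow> real" where
  "rate_deriv u v = - ln v + 1 / 2 * ln (u - v) + 1 / 2 * ln (1 - u - v)"

lemma binary_entropy_pos: "0 < u \<Longrightarrow> u < 1 \<Longrightarrow> binary_entropy u > 0"
  unfolding binary_entropy_def using mult_pos_neg[of u "ln u"] mult_pos_neg[of "1 - u" "ln (1 - u)"] by simp

lemma f_hat_eq_rate: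
  assumes "0 < u" and "u \<le> 1 / 2" and "0 \<le> v" and "v < u" and "d > 0"
  shows "f_hat d u (real d * v) = real d * rate u v + binary_entropy u"
proof -
  define D where "D = real d"
  have D: "D > 0" using assms by (simp add: D_def)
  have split: "(D * x) * ln (D * x) = D * x * ln D + D * (x * ln x)" if "x \<ge> 0" for x
    using that D by (cases "x = 0") (auto simp: ln_mult algebra_simps)
  have 1: "D - D * u = D * (1 - u)" "D * u - D * v = D * (u - v)"
      "D * (1 - u) - D * v = D * (1 - u - v)" by (simp_all add: algebra_simps)
  show ?thesis
    unfolding f_hat_def rate_def binary_entropy_def D_def[symmetric] 1
    using split[of u] split[of "1 - u"] split[of v] split[of "u - v"] split[of "1 - u - v"] assms
    by (simp add: algebra_simps)
qed

lemma has_derivative_rate: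
  assumes "0 < v" and "v < u" and "u \<le> 1 / 2"
  shows "(rate u has_real_derivative rate_deriv u v) (at v)"
  unfolding rate_def rate_deriv_def
  by (rule derivative_eq_intros refl | use assms in \<open>simp add: field_simps\<close>)+

text \<open>
  The sign of the derivative is that of \<open>(u - v) (1 - u - v) - v\<^sup>2 = u (1 - u) - v\<close>.
\<close>

lemma rate_strict_mono:
  assumes u: "0 < u" "u \<le> 1 / 2" and ab: "a < b" "b \<le> u * (1 - u)" and a: "0 < a"
  shows "rate u a < rate u b"
proof (rule DERIV_pos_imp_increasing_open[OF ab(1)])
  have lt: "u * (1 - u) < u" using u by (simp add: algebra_simps)
  fix v assume v: "a < v" "v < b"
  have "v * v < (u - v) * (1 - u - v)"
    using v ab by (simp add: algebra_simps)
  moreover have "0 < v * v" using v a by simp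
  ultimately have "ln (v * v) < ln ((u - v) * (1 - u - v))" by (subst ln_less_cancel_iff) auto
  then have "rate_deriv u v > 0"
    using v a ab lt u by (simp add: rate_deriv_def ln_mult)
  then show "\<exists>y. (rate u has_real_derivative y) (at v) \<and> 0 < y"
    using has_derivative_rate[of v u] v a ab lt u by auto
next
  have lt: "u * (1 - u) < u" using u by (simp add: algebra_simps)
  show "continuous_on {a..b} (rate u)"
  proof (intro continuous_at_imp_continuous_on ballI)
    fix x assume "x \<in> {a..b}"
    then show "isCont (rate u) x"
      using DERIV_isCont[OF has_derivative_rate[of x u]] a ab lt u by auto
  qed
qed

text \<open>
  At \<open>v = u (1 - u)\<close>, the expected density of edges between \<open>U\<close> and its complement, one has
  \<open>u - v = u\<^sup>2\<close> and \<open>1 - u - v = (1 - u)\<^sup>2\<close>, so all logarithms combine.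
\<close>

lemma rate_critical:
  assumes u: "0 < u" "u \<le> 1 / 2"
  shows "rate u (u * (1 - u)) = 0" and "rate_deriv u (u * (1 - u)) = 0"
proof -
  have 1: "u - u * (1 - u) = u * u" "1 - u - u * (1 - u) = (1 - u) * (1 - u)"
    by (simp_all add: algebra_simps)
  have lns: "ln (u * u) = ln u + ln u" "ln ((1 - u) * (1 - u)) = ln (1 - u) + ln (1 - u)"
      "ln (u * (1 - u)) = ln u + ln (1 - u)" using u by (simp_all add: ln_mult)
  show "rate u (u * (1 - u)) = 0" "rate_deriv u (u * (1 - u)) = 0"
    unfolding rate_def rate_deriv_def binary_entropy_def 1 lns by (simp_all add: algebra_simps)
qed

lemma rate_deriv_critical:
  assumes u: "0 < u" "u \<le> 1 / 2"
  shows "(rate_deriv u has_real_derivative - 1 / (2 * (u * (1 - u))\<^sup>2)) (at (u * (1 - u)))"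
proof -
  define w where "w = u * (1 - u)"
  define b where "b = 1 - u"
  have b: "b > 0" "u + b = 1" using u by (simp_all add: b_def)
  have 1: "u - w = u * u" "1 - u - w = b * b" "w = u * b"
    by (simp_all add: w_def b_def algebra_simps)
  have w: "w > 0" "u - w > 0" "1 - u - w > 0" using u b unfolding 1(1,2) by (simp_all add: 1(3))
  have "(rate_deriv u has_real_derivative
      - (1 / w) + 1 / 2 * (- 1 / (u - w)) + 1 / 2 * (- 1 / (1 - u - w))) (at w)"
  proof -
    have "((\<lambda>v. ln (u - v)) has_real_derivative - 1 / (u - w)) (at w)"
      "((\<lambda>v. ln (1 - u - v)) has_real_derivative - 1 / (1 - u - w)) (at w)"
      using w by (auto intro!: derivative_eq_intros)
    moreover have "(ln has_real_derivative 1 / w) (at w)"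
      using w by (auto intro!: derivative_eq_intros)
    ultimately show ?thesis
      unfolding rate_deriv_def by (intro DERIV_add DERIV_minus DERIV_cmult)
  qed
  also have "- (1 / w) + 1 / 2 * (- 1 / (u - w)) + 1 / 2 * (- 1 / (1 - u - w))
      = - (u + b)\<^sup>2 / (2 * w\<^sup>2)"
    unfolding 1(1,2) unfolding 1(3) using u b(1) by (simp add: field_simps power2_eq_square)
  finally show ?thesis using b by (simp add: w_def)
qed

lemma rate_quadratic:
  assumes u: "0 < u" "u \<le> 1 / 2"
  shows "((\<lambda>x. rate u (u * (1 - u) + x) / x\<^sup>2) \<longlongrightarrow> - 1 / (4 * (u * (1 - u))\<^sup>2)) (at 0)"
proof -
  define w where "w = u * (1 - u)"
  have w: "0 < w" "w < u" using u by (simp_all add: w_def algebra_simps)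
  have near: "\<forall>\<^sub>F x in at 0. x \<noteq> 0 \<and> 0 < w + x \<and> w + x < u"
  proof -
    have "((\<lambda>x. w + x) \<longlongrightarrow> w + 0) (at 0)" by (intro tendsto_intros)
    then have "\<forall>\<^sub>F x in at 0. 0 < w + x" "\<forall>\<^sub>F x in at 0. w + x < u"
      using w by (auto intro: order_tendstoD)
    moreover have "\<forall>\<^sub>F x in at (0::real). x \<noteq> 0" by (simp add: eventually_at_filter)
    ultimately show ?thesis by eventually_elim simp
  qed
  show ?thesis
    unfolding w_def[symmetric]
  proof (rule lhopital[where f' = "\<lambda>x. rate_deriv u (w + x)" and g' = "\<lambda>x. 2 * x"])
    have "isCont (rate u) w" using DERIV_isCont[OF has_derivative_rate[OF w u(2)]] .
    then show "(\<lambda>x. rate u (w + x)) \<midarrow>0\<rightarrow> 0"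
      using rate_critical(1)[OF u] by (simp add: isCont_def LIM_offset_zero_iff w_def)
    show "((\<lambda>x::real. x\<^sup>2) \<longlongrightarrow> 0) (at 0)" by (rule tendsto_eq_intros | simp)+
    show "\<forall>\<^sub>F x in at (0::real). x\<^sup>2 \<noteq> 0" "\<forall>\<^sub>F x in at (0::real). 2 * x \<noteq> 0"
      using near by (auto elim: eventually_mono)
    show "\<forall>\<^sub>F x in at 0. ((\<lambda>x. rate u (w + x)) has_real_derivative rate_deriv u (w + x)) (at x)"
      using near
    proof eventually_elim
      case (elim x)
      then have "((\<lambda>x. rate u (x + w)) has_real_derivative rate_deriv u (x + w)) (at x)"
        using has_derivative_rate[of "x + w" u] u by (simp add: DERIV_shift add.commute[of w])
      then show ?case by (simp only: add.commute)
    qed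
    show "\<forall>\<^sub>F x in at (0::real). ((\<lambda>x. x\<^sup>2) has_real_derivative 2 * x) (at x)"
      by (intro always_eventually allI) (auto intro!: derivative_eq_intros)
    have "(\<lambda>x. (rate_deriv u (w + x) - rate_deriv u w) / x) \<midarrow>0\<rightarrow> - 1 / (2 * w\<^sup>2)"
      using rate_deriv_critical[OF u] by (simp add: DERIV_def w_def)
    then have "(\<lambda>x. 1 / 2 * ((rate_deriv u (w + x) - rate_deriv u w) / x))
        \<midarrow>0\<rightarrow> 1 / 2 * (- 1 / (2 * w\<^sup>2))"
      by (intro tendsto_mult tendsto_const)
    then show "(\<lambda>x. rate_deriv u (w + x) / (2 * x)) \<midarrow>0\<rightarrow> - 1 / (4 * w\<^sup>2)"
      using rate_critical(2)[OF u] by (simp add: w_def)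
  qed
qed

text \<open>
  Near its double zero the rate is quadratic, so \<open>d\<close> times the rate converges at distance of
  order \<open>1 / sqrt d\<close>. Equating the limit with minus the entropy yields the constant of
  the second-order term.
\<close>

lemma rate_critical_window:
  assumes u: "0 < u" "u \<le> 1 / 2" and t: "t > 0"
  shows "(\<lambda>d. real d * rate u (u * (1 - u) - t / sqrt (real d)))
     \<longlonglongrightarrow> - (t\<^sup>2 / (4 * (u * (1 - u))\<^sup>2))"
proof -
  define w where "w = u * (1 - u)"
  define x where "x d = - t / sqrt (real d)" for d
  have "filterlim x (at 0) at_top"
    unfolding filterlim_at
  proof
    show "\<forall>\<^sub>F d in at_top. x d \<in> UNIV \<and> x d \<noteq> 0"
      using eventually_gt_at_top[of 0] by eventually_elim (use t in \<open>simp add: x_def\<close>)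
    show "x \<longlonglongrightarrow> 0"
      unfolding x_def
      by (rule real_tendsto_divide_at_top[OF tendsto_const
            filterlim_compose[OF sqrt_at_top filterlim_real_sequentially]])
  qed
  then have "(\<lambda>d. rate u (w + x d) / (x d)\<^sup>2) \<longlonglongrightarrow> - 1 / (4 * w\<^sup>2)"
    unfolding w_def by (rule filterlim_compose[OF rate_quadratic[OF u]])
  then have "(\<lambda>d. t\<^sup>2 * (rate u (w + x d) / (x d)\<^sup>2)) \<longlonglongrightarrow> t\<^sup>2 * (- 1 / (4 * w\<^sup>2))"
    by (intro tendsto_mult tendsto_const)
  then have "(\<lambda>d. t\<^sup>2 * (rate u (w + x d) / (x d)\<^sup>2)) \<longlonglongrightarrow> - (t\<^sup>2 / (4 * w\<^sup>2))"
    by simp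
  then show ?thesis
    unfolding w_def[symmetric]
  proof (rule Lim_transform_eventually)
    show "\<forall>\<^sub>F d in at_top. t\<^sup>2 * (rate u (w + x d) / (x d)\<^sup>2) = real d * rate u (w - t / sqrt (real d))"
      using eventually_gt_at_top[of 0]
      by eventually_elim (use t in \<open>simp add: x_def power_divide\<close>)
  qed
qed

text \<open>
  A root \<open>v\<close> on the increasing branch is the least admissible point: monotonicity excludes the
  smaller positive points. At the end point \<open>0\<close>, where the derivative is infinite, the value
  \<open>- binary_entropy u / 2\<close> of the rate is used instead, and \<open>d \<ge> 3\<close> makes it small enough.
\<close>

lemma A_hat_eq_root:
  assumes u: "0 < u" "u \<le> 1 / 2" and d: "d \<ge> 3"
    and v: "0 < v" "v \<le> u * (1 - u)" and root: "real d * rate u v = - binary_entropy u"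
  shows "A_hat d u = real d * v / u"
proof -
  have lt: "u * (1 - u) < u" using u by (simp add: algebra_simps)
  have h: "binary_entropy u > 0" using binary_entropy_pos u by simp
  have "(LEAST y. 0 \<le> y \<and> y \<le> real d * u \<and> f_hat d u y \<ge> 0) = real d * v"
  proof (rule Least_equality)
    show "0 \<le> real d * v \<and> real d * v \<le> real d * u \<and> f_hat d u (real d * v) \<ge> 0"
      using f_hat_eq_rate[of u v d] u v lt d root by simp
  next
    fix y assume y: "0 \<le> y \<and> y \<le> real d * u \<and> f_hat d u y \<ge> 0"
    show "real d * v \<le> y"
    proof (rule ccontr)
      assume "\<not> real d * v \<le> y"
      define x where "x = y / real d"
      have x: "y = real d * x" "0 \<le> x" "x < v"
        using d y \<open>\<not> real d * v \<le> y\<close> by (auto simp: x_def field_simps)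
      have "real d * rate u x + binary_entropy u < 0"
      proof (cases "x = 0")
        case True
        have "rate u 0 = - binary_entropy u / 2" by (simp add: rate_def binary_entropy_def field_simps)
        moreover have "real d * binary_entropy u \<ge> 3 * binary_entropy u" using d h by (intro mult_right_mono) auto
        ultimately show ?thesis using True h by simp
      next
        case False
        then have "rate u x < rate u v" using rate_strict_mono[of u x v] u x v by simp
        then have "real d * rate u x < real d * rate u v" using d by simp
        then show ?thesis using root by simp
      qed
      then show False using y x f_hat_eq_rate[of u x d] u v lt d by simp
    qed
  qed
  then show ?thesis by (simp add: A_hat_def)
qed

text \<open>
  The constant \<open>c\<close> solves \<open>c\<^sup>2 / (4 (u (1 - u))\<^sup>2) = binary_entropy u\<close>. Replacing it by
  \<open>c \<plusminus> \<delta>\<close> makes the limit in the critical window lie strictly on either side of zero, and the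
  intermediate value theorem locates the root in between.
\<close>

lemma A_hat_eventually_near:
  fixes u \<delta> :: real
  assumes u: "0 < u" "u \<le> 1 / 2"
  defines "c \<equiv> 2 * (u * (1 - u)) * sqrt (binary_entropy u)"
  assumes \<delta>: "0 < \<delta>" "\<delta> < c"
  shows "\<forall>\<^sub>F d in at_top. \<bar>A_hat d u - real d / u * (u * (1 - u) - c / sqrt (real d))\<bar>
           \<le> \<delta> / u * sqrt (real d)"
proof -
  define w where "w = u * (1 - u)"
  have w: "0 < w" "w < u" using u by (simp_all add: w_def algebra_simps)
  have h: "binary_entropy u > 0" using binary_entropy_pos u by simp
  have c: "c\<^sup>2 = 4 * w\<^sup>2 * binary_entropy u" "c > 0"
    using h w u by (simp_all add: c_def w_def power_mult_distrib)
  have lower: "\<forall>\<^sub>F d in at_top. real d * rate u (w - (c + \<delta>) / sqrt (real d)) < - binary_entropy u"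
  proof -
    have "c\<^sup>2 < (c + \<delta>)\<^sup>2" using c \<delta> by (intro power_strict_mono) auto
    then have "- ((c + \<delta>)\<^sup>2 / (4 * w\<^sup>2)) < - binary_entropy u"
      using c w by (simp add: field_simps)
    then show ?thesis
      using rate_critical_window[OF u, of "c + \<delta>"] c \<delta> unfolding w_def
      by (intro order_tendstoD) auto
  qed
  have upper: "\<forall>\<^sub>F d in at_top. real d * rate u (w - (c - \<delta>) / sqrt (real d)) > - binary_entropy u"
  proof -
    have "(c - \<delta>)\<^sup>2 < c\<^sup>2" using c \<delta> by (intro power_strict_mono) auto
    then have "- ((c - \<delta>)\<^sup>2 / (4 * w\<^sup>2)) > - binary_entropy u"
      using c w by (simp add: field_simps)
    then show ?thesis
      using rate_critical_window[OF u, of "c - \<delta>"] c \<delta> unfolding w_def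
      by (intro order_tendstoD) auto
  qed
  have "(\<lambda>d. w - (c + \<delta>) / sqrt (real d)) \<longlonglongrightarrow> w - 0"
    by (intro tendsto_diff tendsto_const real_tendsto_divide_at_top[OF tendsto_const
            filterlim_compose[OF sqrt_at_top filterlim_real_sequentially]])
  then have positive: "\<forall>\<^sub>F d in at_top. 0 < w - (c + \<delta>) / sqrt (real d)"
    using w by (intro order_tendstoD) auto
  show ?thesis
    using lower upper positive eventually_ge_at_top[of 3]
  proof eventually_elim
    case (elim d)
    define r where "r = sqrt (real d)"
    have r: "r > 0" "r * r = real d" using elim by (simp_all add: r_def)
    have le: "w - (c + \<delta>) / r \<le> w - (c - \<delta>) / r" using \<delta> r by (simp add: divide_right_mono)
    have top: "w - (c - \<delta>) / r \<le> w" using \<delta> r by simp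
    have "\<exists>v\<ge>w - (c + \<delta>) / r. v \<le> w - (c - \<delta>) / r \<and> rate u v = - binary_entropy u / real d"
    proof (rule IVT'[OF _ _ le])
      show "rate u (w - (c + \<delta>) / r) \<le> - binary_entropy u / real d"
        "- binary_entropy u / real d \<le> rate u (w - (c - \<delta>) / r)"
        using elim by (simp_all add: r_def field_simps)
      show "continuous_on {w - (c + \<delta>) / r..w - (c - \<delta>) / r} (rate u)"
      proof (intro continuous_at_imp_continuous_on ballI)
        fix x assume "x \<in> {w - (c + \<delta>) / r..w - (c - \<delta>) / r}"
        then show "isCont (rate u) x"
          using DERIV_isCont[OF has_derivative_rate[of x u]] elim top w u by (auto simp: r_def)
      qed
    qed
    then obtain v where v: "w - (c + \<delta>) / r \<le> v" "v \<le> w - (c - \<delta>) / r"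
        "rate u v = - binary_entropy u / real d" by blast
    have "A_hat d u = real d * v / u"
    proof (rule A_hat_eq_root[OF u])
      show "d \<ge> 3" using elim by simp
      show "0 < v" using v(1) elim(3) by (simp add: r_def)
      show "v \<le> u * (1 - u)" using v(2) top by (simp add: w_def)
      show "real d * rate u v = - binary_entropy u" using v(3) elim by simp
    qed
    then have "A_hat d u - real d / u * (w - c / r) = real d / u * (v - (w - c / r))"
      by (simp add: algebra_simps)
    moreover have "\<bar>v - (w - c / r)\<bar> \<le> \<delta> / r"
      using v by (simp add: abs_le_iff add_divide_distrib diff_divide_distrib)
    then have "real d / u * \<bar>v - (w - c / r)\<bar> \<le> real d / u * (\<delta> / r)"
      using u by (intro mult_left_mono) auto
    moreover have "real d / u * (\<delta> / r) = \<delta> / u * r"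
      using r u by (simp add: field_simps flip: r(2))
    ultimately show ?case
      using u by (simp add: abs_mult w_def r_def)
  qed
qed

lemma A_hat_asymptotics:
  fixes u :: real
  assumes u: "0 < u" "u \<le> 1 / 2"
  shows "(\<lambda>d. A_hat d u -
            (real d * (1 - u)
              - 2 * (1 - u) * sqrt (real d * ln (u powr (- u) * (1 - u) powr (u - 1)))))
           \<in> o[at_top](\<lambda>d. sqrt (real d))"
proof (rule landau_o.smallI)
  fix e :: real assume e: "e > 0"
  define c where "c = 2 * (u * (1 - u)) * sqrt (binary_entropy u)"
  \<comment> \<open>The first bound keeps \<open>c - \<delta>\<close> positive, the second gives the required precision.\<close>
  define \<delta> where "\<delta> = min (c / 2) (e * u)"
  have h: "binary_entropy u > 0" using binary_entropy_pos u by simp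
  have ent: "ln (u powr (- u) * (1 - u) powr (u - 1)) = binary_entropy u"
    using u by (simp add: ln_mult ln_powr binary_entropy_def algebra_simps)
  have "c > 0" using h u by (simp add: c_def)
  then have \<delta>: "0 < \<delta>" "\<delta> < c" using u e by (auto simp: \<delta>_def)
  have \<delta>e: "\<delta> / u \<le> e" using u by (simp add: \<delta>_def min_le_iff_disj field_simps)
  show "\<forall>\<^sub>F d in at_top. norm (A_hat d u -
            (real d * (1 - u)
              - 2 * (1 - u) * sqrt (real d * ln (u powr (- u) * (1 - u) powr (u - 1)))))
          \<le> e * norm (sqrt (real d))"
    using A_hat_eventually_near[OF u \<delta>[unfolded c_def], folded c_def] eventually_gt_at_top[of 0]
  proof eventually_elim
    case (elim d)
    have "real d / u * (u * (1 - u) - c / sqrt (real d))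
        = real d * (1 - u) - 2 * (1 - u) * sqrt (real d * binary_entropy u)"
    proof -
      have "real d / sqrt (real d) = sqrt (real d)" by (simp add: real_div_sqrt)
      then have "real d / u * (c / sqrt (real d)) = c / u * sqrt (real d)"
        by (metis times_divide_eq_left times_divide_eq_right mult.commute)
      also have "\<dots> = 2 * (1 - u) * sqrt (real d * binary_entropy u)"
        using u by (simp add: c_def real_sqrt_mult)
      finally show ?thesis using u by (simp add: right_diff_distrib)
    qed
    moreover have "\<delta> / u * sqrt (real d) \<le> e * sqrt (real d)"
      using \<delta>e by (intro mult_right_mono) auto
    ultimately show ?case using elim unfolding ent by simp
  qed
qed

section \<open>Conclusion\<close>

theorem corollary4:
  fixes u :: real
  assumes "0 < u" and "u \<le> 1 / 2"
  shows "(\<lambda>d. A_hat d u -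
            (real d * (1 - u)
              - 2 * (1 - u) * sqrt (real d * ln (u powr (- u) * (1 - u) powr (u - 1)))))
           \<in> o[at_top](\<lambda>d. sqrt (real d))
         \<and> (\<exists>\<epsilon> :: nat \<Rightarrow> real. \<epsilon> \<in> o[at_top](\<lambda>_. 1) \<and>
              (\<forall>\<^sub>F d in at_top. regular_expansion u d \<ge> real d * (1 - u + \<epsilon> d)))"
  using A_hat_asymptotics[OF assms] regular_expansion_asymptotic_lower[OF assms(1)] by blast

end
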